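(* For all real numbers $\theta_1,\ldots,\theta_n$, $$\mathcal{A}\bigl((t+\theta_1)\cdots(t+\theta_n)\bigr)=\sum_{k=0}^n e_{n-k}(\theta_1,\ldots,\theta_n)A_k(t)=\sum_{\sigma\in\mathfrak{S}_n^2}t^{\mathrm{exc}(\sigma)}\prod_{i\in F_0(\sigma)}\theta_i,$$ where $e_k(\theta_1,\ldots,\theta_n)=\sum_{1\le i_1<i_2<\cdots<i_k\le n}\theta_{i_1}\theta_{i_2}\cdots\theta_{i_k}$ is the $k$-th elementary symmetric polynomial in $\theta_1,\ldots,\theta_n$.
   Context: For $n\ge 0$, the $n$-th Eulerian polynomial is $A_n(t)=\sum_{k=0}^n A_{nk}t^k$, where $A_{nk}$ is the number of permutations $\sigma$ of $[n]=\{1,\dots,n\}$ such that $\sigma(i)\ge i$ for exactly $k$ indices $i$ (so $A_0(t)=1$). The map $\mathcal{A}:\mathbb{R}[t]\to\mathbb{R}[t]$ is the $\mathbb{R}$-linear operator determined by $\mathcal{A}(t^n)=A_n(t)$ for all $n\ge 0$. $\mathfrak{S}_n^2$ denotes the set of decorated permutations, i.e. the set of all permutations of $[n]$ in which each fixed point is colored by either $0$ or $1$. For $\sigma\in\mathfrak{S}_n^2$ and $c\in\{0,1\}$, $F_c(\sigma)=\{i:\sigma(i)=i\text{ and } i\text{ has color }c\}$, and $\mathrm{exc}(\sigma)=|\{i:\sigma(i)>i\}|+|F_1(\sigma)|$. *)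

theory Defs
  imports
    "HOL-Computational_Algebra.Polynomial"
    "HOL-Combinatorics.Permutations"
    "HOL-Library.FuncSet"
begin

definition eulerian_number :: "nat \<Rightarrow> nat \<Rightarrow> nat" where
  "eulerian_number n k =
     card {\<sigma>. \<sigma> permutes {1..n} \<and> card {i \<in> {1..n}. \<sigma> i \<ge> i} = k}"

definition eulerian_poly :: "nat \<Rightarrow> real poly" where
  "eulerian_poly n = (\<Sum>k=0..n. monom (real (eulerian_number n k)) k)"

text \<open>
  The linear operator sending each power $t^n$ to the $n$-th Eulerian polynomial, given by
  its value on the monomial expansion of the argument. The lemmas below show that it is
  linear with these values on the powers of $t$, and that it is the only such map.
\<close>

definition eulerian_op :: "real poly \<Rightarrow> real poly" where
  "eulerian_op p = (\<Sum>k\<le>degree p. smult (coeff p k) (eulerian_poly k))"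

lemma eulerian_op_altdef:
  assumes "degree p \<le> N"
  shows "eulerian_op p = (\<Sum>k\<le>N. smult (coeff p k) (eulerian_poly k))"
  unfolding eulerian_op_def
  by (rule sum.mono_neutral_left) (use assms in \<open>auto simp: coeff_eq_0\<close>)

lemma eulerian_op_monom: "eulerian_op (monom 1 n) = eulerian_poly n"
  by (simp add: eulerian_op_altdef[of _ n] degree_monom_le if_distrib[of "\<lambda>c. smult c _"]
      cong: if_cong)

lemma linear_eulerian_op: "Vector_Spaces.linear smult smult eulerian_op"
proof -
  have vs: "vector_space (smult :: real \<Rightarrow> real poly \<Rightarrow> real poly)"
    by unfold_locales (simp_all add: smult_add_right smult_add_left)
  have add: "eulerian_op (p + q) = eulerian_op p + eulerian_op q" for p q
  proof -
    define N where "N = max (degree p) (degree q)"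
    have "degree p \<le> N" "degree q \<le> N" "degree (p + q) \<le> N"
      by (auto simp: N_def degree_add_le)
    then show ?thesis
      by (simp add: eulerian_op_altdef[of _ N] smult_add_left sum.distrib)
  qed
  have scale: "eulerian_op (smult c p) = smult c (eulerian_op p)" for c p
  proof -
    have sum: "smult c (sum f A) = (\<Sum>x\<in>A. smult c (f x))"
      for f :: "nat \<Rightarrow> real poly" and A
      by (induction A rule: infinite_finite_induct) (simp_all add: smult_add_right)
    show ?thesis
      by (simp add: eulerian_op_altdef[of _ "degree p"] sum)
  qed
  show ?thesis
    unfolding Vector_Spaces.linear_iff_module_hom module_hom_iff
    using vs add scale by (simp add: module_iff_vector_space)
qed

lemma eulerian_op_unique:
  assumes "Vector_Spaces.linear smult smult L"
    and "\<And>n. L (monom 1 n) = eulerian_poly n"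
  shows "L = eulerian_op"
proof
  fix p
  interpret L: Vector_Spaces.linear smult smult L by fact
  have "L p = L (\<Sum>k\<le>degree p. smult (coeff p k) (monom 1 k))"
    by (simp add: smult_monom poly_as_sum_of_monoms)
  also have "\<dots> = eulerian_op p"
    by (simp add: L.sum L.scale assms(2) eulerian_op_def)
  finally show "L p = eulerian_op p" .
qed

definition esymm :: "nat \<Rightarrow> nat \<Rightarrow> (nat \<Rightarrow> real) \<Rightarrow> real" where
  "esymm k n \<theta> = (\<Sum>S | S \<subseteq> {1..n} \<and> card S = k. \<Prod>i\<in>S. \<theta> i)"

text \<open>
  A decorated permutation is a pair of a permutation and a colouring of its fixed points.
  The extensional function space makes the colouring trivial off the fixed points in
  $\{1, \dots, n\}$, so that each decorated permutation is represented exactly once.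
\<close>

definition decorated_permutations :: "nat \<Rightarrow> ((nat \<Rightarrow> nat) \<times> (nat \<Rightarrow> nat)) set" where
  "decorated_permutations n =
     (SIGMA \<sigma>:{\<sigma>. \<sigma> permutes {1..n}}. {i \<in> {1..n}. \<sigma> i = i} \<rightarrow>\<^sub>E {0, 1})"

definition fixed_points :: "nat \<Rightarrow> nat \<Rightarrow> (nat \<Rightarrow> nat) \<times> (nat \<Rightarrow> nat) \<Rightarrow> nat set" where
  "fixed_points n c \<sigma> = {i \<in> {1..n}. fst \<sigma> i = i \<and> snd \<sigma> i = c}"

definition exc :: "nat \<Rightarrow> (nat \<Rightarrow> nat) \<times> (nat \<Rightarrow> nat) \<Rightarrow> nat" where
  "exc n \<sigma> = card {i \<in> {1..n}. fst \<sigma> i > i} + card (fixed_points n 1 \<sigma>)"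

end

theory Submission
  imports Defs
begin

text \<open>
  All three expressions equal the sum
  $\sum_{S \subseteq [n]} \bigl(\prod_{i \in S} \theta_i\bigr) A_{n - |S|}(t)$ over subsets of $[n]$.

  Multiplying out $\prod_i (t + \theta_i)$ means choosing the set $S$ of factors that contribute
  their constant term, which leaves $t^{n - |S|}$; applying the linear operator turns this power
  into $A_{n - |S|}(t)$. Collecting the subsets of equal size gives the elementary symmetric
  polynomials.

  On the combinatorial side, the role of $S$ is played by the set $F_0(\sigma)$ of fixed points
  coloured $0$. Once $S$ is prescribed, a decorated permutation is nothing but a permutation of
  $[n] \setminus S$, all of whose fixed points have colour $1$; its number of excedances is then
  the number of weak excedances of that permutation
  (\<open>sum_decorated_permutations_by_zero_fixed_points\<close>).
  Weak excedances only depend on the relative order of the elements, so the permutations of any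
  $m$-element set of naturals have $A_m(t)$ as generating polynomial
  (\<open>sum_weak_exc_eq_eulerian_poly\<close>).
\<close>

definition weak_exc :: "nat set \<Rightarrow> (nat \<Rightarrow> nat) \<Rightarrow> nat" where
  "weak_exc T \<sigma> = card {i \<in> T. \<sigma> i \<ge> i}"

lemma eulerian_poly_eq_sum_weak_exc:
  "eulerian_poly n = (\<Sum>\<sigma> | \<sigma> permutes {1..n}. monom 1 (weak_exc {1..n} \<sigma>))"
proof -
  let ?P = "{\<sigma>. \<sigma> permutes {1..n}}"
  have "weak_exc {1..n} \<sigma> \<le> n" for \<sigma>
    using card_mono[of "{1..n}" "{i \<in> {1..n}. \<sigma> i \<ge> i}"] unfolding weak_exc_def by force
  then have bound: "weak_exc {1..n} ` ?P \<subseteq> {0..n}"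
    by auto
  have "(\<Sum>\<sigma>\<in>?P. monom (1 :: real) (weak_exc {1..n} \<sigma>)) =
      (\<Sum>k=0..n. of_nat (card {\<sigma> \<in> ?P. weak_exc {1..n} \<sigma> = k}) * monom 1 k)"
    by (rule sum_fun_comp[OF _ _ bound]) (simp_all add: finite_permutations)
  then show ?thesis
    by (simp add: eulerian_poly_def eulerian_number_def weak_exc_def of_nat_poly smult_monom)
qed

text \<open>
  Conjugation by an increasing bijection carries permutations of one set to permutations of the
  other and preserves every comparison between $i$ and $\sigma(i)$.
\<close>

lemma sum_weak_exc_strict_mono_bij:
  fixes f :: "nat \<Rightarrow> nat"
  assumes f: "bij_betw f A B" and mono: "strict_mono_on A f"
  shows "(\<Sum>\<sigma> | \<sigma> permutes B. monom (1 :: real) (weak_exc B \<sigma>)) =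
    (\<Sum>\<sigma> | \<sigma> permutes A. monom 1 (weak_exc A \<sigma>))"
proof -
  let ?conj = "\<lambda>\<sigma> x. if x \<in> B then f (\<sigma> (inv_into A f x)) else x"
  have inj: "inj_on f A" and B: "f ` A = B"
    using f by (auto simp: bij_betw_def)
  have exc: "weak_exc B (?conj \<sigma>) = weak_exc A \<sigma>" if "\<sigma> permutes A" for \<sigma>
  proof -
    have "?conj \<sigma> (f i) \<ge> f i \<longleftrightarrow> \<sigma> i \<ge> i" if "i \<in> A" for i
      using that B inj permutes_in_image[OF \<open>\<sigma> permutes A\<close>] strict_mono_on_less_eq[OF mono]
      by auto
    then have "{x \<in> B. ?conj \<sigma> x \<ge> x} = f ` {i \<in> A. \<sigma> i \<ge> i}"
      using B by blast
    then show ?thesis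
      using inj unfolding weak_exc_def
      by (metis (no_types, lifting) card_image inj_on_subset mem_Collect_eq subsetI)
  qed
  have "(\<Sum>\<sigma> | \<sigma> permutes A. monom (1 :: real) (weak_exc B (?conj \<sigma>))) =
      (\<Sum>\<sigma> | \<sigma> permutes B. monom 1 (weak_exc B \<sigma>))"
    by (rule sum.reindex_bij_betw[OF bij_betw_permutations[OF f]])
  then show ?thesis
    using exc by simp
qed

lemma sum_weak_exc_eq_eulerian_poly:
  assumes "finite T"
  shows "(\<Sum>\<sigma> | \<sigma> permutes T. monom 1 (weak_exc T \<sigma>)) = eulerian_poly (card T)"
proof -
  obtain h where h: "bij_betw h {..<card T} T" "strict_mono_on {..<card T} h"
    using ex_bij_betw_strict_mono_card[OF assms] by blast
  have "bij_betw Suc {..<card T} {1..card T}"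
    by (auto simp: bij_betw_def image_Suc_lessThan)
  moreover have "strict_mono_on {..<card T} Suc"
    by (auto simp: strict_mono_on_def)
  ultimately show ?thesis
    using sum_weak_exc_strict_mono_bij h by (metis eulerian_poly_eq_sum_weak_exc)
qed

text \<open>
  The colouring is determined by $S = F_0(\sigma)$, and $\sigma$ fixes $S$ pointwise, so sending
  $\sigma$ to its underlying permutation, paired with $S$, is a bijection onto pairs of a subset
  $S$ and a permutation of the complement of $S$.
\<close>

lemma sum_decorated_permutations_by_zero_fixed_points:
  fixes g :: "nat set \<Rightarrow> nat \<Rightarrow> 'a :: comm_monoid_add"
  shows "(\<Sum>\<sigma>\<in>decorated_permutations n. g (fixed_points n 0 \<sigma>) (exc n \<sigma>)) =
    (\<Sum>S\<in>Pow {1..n}. \<Sum>\<tau> | \<tau> permutes {1..n} - S. g S (weak_exc ({1..n} - S) \<tau>))"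
proof -
  let ?colour = "\<lambda>S \<tau> i. if i \<in> {1..n} \<and> \<tau> i = i then (if i \<in> S then 0 else 1) else undefined"
  let ?pairs = "SIGMA S:Pow {1..n}. {\<tau>. \<tau> permutes {1..n} - S}"
  have "(\<Sum>\<sigma>\<in>decorated_permutations n. g (fixed_points n 0 \<sigma>) (exc n \<sigma>)) =
      (\<Sum>(S, \<tau>)\<in>?pairs. g S (weak_exc ({1..n} - S) \<tau>))"
  proof (rule sum.reindex_bij_witness[where j = "\<lambda>\<sigma>. (fixed_points n 0 \<sigma>, fst \<sigma>)"
        and i = "\<lambda>(S, \<tau>). (\<tau>, ?colour S \<tau>)"])
    fix \<sigma> assume \<sigma>: "\<sigma> \<in> decorated_permutations n"
    obtain \<tau> c where [simp]: "\<sigma> = (\<tau>, c)"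
      by (cases \<sigma>)
    have \<tau>: "\<tau> permutes {1..n}" and c: "c \<in> {i \<in> {1..n}. \<tau> i = i} \<rightarrow>\<^sub>E {0, 1}"
      using \<sigma> by (auto simp: decorated_permutations_def)
    have col: "c i = 0 \<or> c i = 1" if "i \<in> {1..n}" "\<tau> i = i" for i
      using c that by (auto simp: PiE_iff)
    have undef: "c i = undefined" if "\<not> (i \<in> {1..n} \<and> \<tau> i = i)" for i
      using c that by (auto simp: PiE_iff extensional_def)
    show "(case (fixed_points n 0 \<sigma>, fst \<sigma>) of (S, \<tau>) \<Rightarrow> (\<tau>, ?colour S \<tau>)) = \<sigma>"
      using col undef by (fastforce simp: fixed_points_def fun_eq_iff)
    have "\<tau> permutes {1..n} - fixed_points n 0 \<sigma>"
      by (rule permutes_superset[OF \<tau>]) (auto simp: fixed_points_def)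
    then show "(fixed_points n 0 \<sigma>, fst \<sigma>) \<in> ?pairs"
      by (auto simp: fixed_points_def)
    \<comment> \<open>The fixed points remaining after the removal of $F_0(\<sigma>)$ have colour 1, so every weak
      excedance there is counted by \<open>exc\<close>.\<close>
    have "{i \<in> {1..n} - fixed_points n 0 \<sigma>. \<tau> i \<ge> i} =
        {i \<in> {1..n}. \<tau> i > i} \<union> fixed_points n 1 \<sigma>"
      using col by (force simp: fixed_points_def)
    moreover have "{i \<in> {1..n}. \<tau> i > i} \<inter> fixed_points n 1 \<sigma> = {}"
      by (auto simp: fixed_points_def)
    ultimately have "weak_exc ({1..n} - fixed_points n 0 \<sigma>) \<tau> = exc n \<sigma>"
      by (simp add: weak_exc_def exc_def card_Un_disjoint fixed_points_def)
    then show "(case (fixed_points n 0 \<sigma>, fst \<sigma>) of (S, \<tau>) \<Rightarrow> g S (weak_exc ({1..n} - S) \<tau>)) =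
        g (fixed_points n 0 \<sigma>) (exc n \<sigma>)"
      by simp
  next
    fix p assume "p \<in> ?pairs"
    then obtain S \<tau> where [simp]: "p = (S, \<tau>)" and S: "S \<subseteq> {1..n}"
      and \<tau>: "\<tau> permutes {1..n} - S"
      by auto
    have "\<tau> i = i" if "i \<in> S" for i
      using \<tau> that by (auto simp: permutes_def)
    then show "(\<lambda>\<sigma>. (fixed_points n 0 \<sigma>, fst \<sigma>)) (case p of (S, \<tau>) \<Rightarrow> (\<tau>, ?colour S \<tau>)) = p"
      using S by (auto simp: fixed_points_def)
    show "(case p of (S, \<tau>) \<Rightarrow> (\<tau>, ?colour S \<tau>)) \<in> decorated_permutations n"
      using permutes_subset[OF \<tau>, of "{1..n}"]
      by (auto simp: decorated_permutations_def PiE_iff extensional_def)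
  qed
  also have "\<dots> = (\<Sum>S\<in>Pow {1..n}. \<Sum>\<tau> | \<tau> permutes {1..n} - S. g S (weak_exc ({1..n} - S) \<tau>))"
    by (rule sum.Sigma[symmetric]) (auto simp: finite_permutations)
  finally show ?thesis .
qed

lemma sum_decorated_permutations_eq_sum_subsets:
  "(\<Sum>\<sigma>\<in>decorated_permutations n.
      monom 1 (exc n \<sigma>) * [:\<Prod>i\<in>fixed_points n 0 \<sigma>. \<theta> i:]) =
    (\<Sum>S\<in>Pow {1..n}. smult (\<Prod>i\<in>S. \<theta> i) (eulerian_poly (n - card S)))"
proof -
  have "(\<Sum>\<sigma>\<in>decorated_permutations n.
      monom 1 (exc n \<sigma>) * [:\<Prod>i\<in>fixed_points n 0 \<sigma>. \<theta> i:]) =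
      (\<Sum>S\<in>Pow {1..n}. \<Sum>\<tau> | \<tau> permutes {1..n} - S.
        monom 1 (weak_exc ({1..n} - S) \<tau>) * [:\<Prod>i\<in>S. \<theta> i:])"
    by (rule sum_decorated_permutations_by_zero_fixed_points)
  also have "\<dots> = (\<Sum>S\<in>Pow {1..n}. smult (\<Prod>i\<in>S. \<theta> i) (eulerian_poly (card ({1..n} - S))))"
    unfolding sum_distrib_right[symmetric]
    by (intro sum.cong refl) (simp add: sum_weak_exc_eq_eulerian_poly)
  also have "\<dots> = (\<Sum>S\<in>Pow {1..n}. smult (\<Prod>i\<in>S. \<theta> i) (eulerian_poly (n - card S)))"
    by (intro sum.cong refl) (auto simp: card_Diff_subset finite_subset)
  finally show ?thesis .
qed

lemma prod_linear_eq_sum_subsets: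
  fixes \<theta> :: "'b \<Rightarrow> 'a :: comm_ring_1"
  assumes "finite A"
  shows "(\<Prod>i\<in>A. [:\<theta> i, 1:]) =
    (\<Sum>S\<in>Pow A. smult (\<Prod>i\<in>S. \<theta> i) (monom 1 (card A - card S)))"
proof -
  have "(\<Prod>i\<in>A. [:\<theta> i, 1:]) = (\<Prod>i\<in>A. [:\<theta> i:] + [:0, 1:])"
    by simp
  also have "\<dots> = (\<Sum>S\<in>Pow A. (\<Prod>i\<in>S. [:\<theta> i:]) * (\<Prod>i\<in>A - S. [:0, 1:]))"
    by (rule prod_add[OF assms])
  also have "\<dots> = (\<Sum>S\<in>Pow A. smult (\<Prod>i\<in>S. \<theta> i) (monom 1 (card A - card S)))"
  proof (intro sum.cong refl)
    fix S assume "S \<in> Pow A"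
    then have "card (A - S) = card A - card S"
      using assms by (auto simp: card_Diff_subset finite_subset)
    moreover have "(\<Prod>i\<in>S. [:\<theta> i:]) = [:\<Prod>i\<in>S. \<theta> i:]"
      by (induction S rule: infinite_finite_induct) (simp_all add: one_pCons)
    ultimately show "(\<Prod>i\<in>S. [:\<theta> i:]) * (\<Prod>i\<in>A - S. [:0, 1:]) =
        smult (\<Prod>i\<in>S. \<theta> i) (monom 1 (card A - card S))"
      by (simp add: monom_altdef)
  qed
  finally show ?thesis .
qed

lemma eulerian_op_prod_linear_eq_sum_subsets:
  "eulerian_op (\<Prod>i=1..n. [:\<theta> i, 1:]) =
    (\<Sum>S\<in>Pow {1..n}. smult (\<Prod>i\<in>S. \<theta> i) (eulerian_poly (n - card S)))"
proof -
  interpret Vector_Spaces.linear smult smult eulerian_op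
    by (rule linear_eulerian_op)
  show ?thesis
    by (simp add: prod_linear_eq_sum_subsets sum scale eulerian_op_monom)
qed

lemma sum_esymm_eq_sum_subsets:
  "(\<Sum>k=0..n. smult (esymm (n - k) n \<theta>) (p k)) =
    (\<Sum>S\<in>Pow {1..n}. smult (\<Prod>i\<in>S. \<theta> i) (p (n - card S)))"
proof -
  have card_le: "card S \<le> n" if "S \<subseteq> {1..n}" for S
    using card_mono[OF _ that] by simp
  have "(\<Sum>S\<in>Pow {1..n}. smult (\<Prod>i\<in>S. \<theta> i) (p (n - card S))) =
      (\<Sum>k=0..n. \<Sum>S | S \<in> Pow {1..n} \<and> n - card S = k. smult (\<Prod>i\<in>S. \<theta> i) (p (n - card S)))"
    by (rule sum.group[symmetric]) auto
  also have "\<dots> = (\<Sum>k=0..n. smult (esymm (n - k) n \<theta>) (p k))"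
  proof (intro sum.cong refl)
    fix k assume "k \<in> {0..n}"
    then have "{S. S \<in> Pow {1..n} \<and> n - card S = k} = {S. S \<subseteq> {1..n} \<and> card S = n - k}"
      using card_le by fastforce
    then show "(\<Sum>S | S \<in> Pow {1..n} \<and> n - card S = k. smult (\<Prod>i\<in>S. \<theta> i) (p (n - card S))) =
        smult (esymm (n - k) n \<theta>) (p k)"
      using \<open>k \<in> {0..n}\<close> by (simp add: esymm_def smult_sum)
  qed
  finally show ?thesis ..
qed

theorem proposition3p1:
  fixes n :: nat and \<theta> :: "nat \<Rightarrow> real"
  shows "eulerian_op (\<Prod>i=1..n. [:\<theta> i, 1:]) =
           (\<Sum>k=0..n. smult (esymm (n - k) n \<theta>) (eulerian_poly k)) \<and>
         (\<Sum>k=0..n. smult (esymm (n - k) n \<theta>) (eulerian_poly k)) =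
           (\<Sum>\<sigma>\<in>decorated_permutations n.
              monom 1 (exc n \<sigma>) * [:\<Prod>i\<in>fixed_points n 0 \<sigma>. \<theta> i:])"
  by (simp only: eulerian_op_prod_linear_eq_sum_subsets sum_esymm_eq_sum_subsets
      sum_decorated_permutations_eq_sum_subsets)

end
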